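(* Let $P_m$ be the path with $m\ge0$ edges. Then \[ \mathrm{vol}(\mathscr{Q}(P_m))=\frac{\mathrm{vol}(\mathscr{O}(P_m))}{2^m}=\frac{A_{2m+1}}{2^m(2m+1)!}, \] volumes being taken in $\mathbb{R}^{2m+1}$.
   Context: The path $P_m$ has vertices $1,\dots,m+1$ and edges $(i,i+1)$. For a graph $G=(V,E)$, polytopes live in $\mathbb{R}^{|V|+|E|}$ with coordinates $x_i$ ($i\in V$), $y_{ij}$ ($(i,j)\in E$). $\mathscr{Q}(G)$: points with all coordinates in $[0,1]$ satisfying for each edge $(i,j)$: $y_{ij}\ge0$, $y_{ij}\le x_i$, $y_{ij}\le x_j$, $x_i+x_j\le1+y_{ij}$. $\mathscr{O}(G)$: points with all coordinates in $[0,1]$ satisfying $y_{ij}\le x_i$, $y_{ij}\le x_j$ for each edge. The Euler number $A_k$ ($k\ge1$) is the number of permutations $w$ of $\{1,\dots,k\}$ with $w_1>w_2<w_3>\cdots$ (alternating permutations); $A_0:=1$. *)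

theory Defs
  imports "HOL-Analysis.Analysis" "HOL-Combinatorics.Permutations"
begin

text \<open>A simple graph is a pair of a vertex set and a set of two-element vertex sets.\<close>

type_synonym 'a graph = "'a set \<times> 'a set set"

abbreviation verts :: "'a graph \<Rightarrow> 'a set" where "verts \<equiv> fst"
abbreviation edges :: "'a graph \<Rightarrow> 'a set set" where "edges \<equiv> snd"

definition path_graph :: "nat \<Rightarrow> nat graph" where
  "path_graph m = ({1..m+1}, {{i, i+1} | i. i \<in> {1..m}})"

text \<open>
  Points of the coordinate space of \<open>G\<close> are functions on \<open>verts G <+> edges G\<close>:
  \<open>z (Inl i)\<close> is the coordinate \<open>x\<close> at the vertex \<open>i\<close>, and \<open>z (Inr {i, j})\<close>
  is the coordinate \<open>y\<close> at the edge \<open>{i, j}\<close>.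
\<close>

definition coords :: "'a graph \<Rightarrow> ('a + 'a set) set" where
  "coords G = verts G <+> edges G"

definition cube :: "'a graph \<Rightarrow> ('a + 'a set \<Rightarrow> real) set" where
  "cube G = (\<Pi>\<^sub>E c\<in>coords G. {0..1})"

definition Q_polytope :: "'a graph \<Rightarrow> ('a + 'a set \<Rightarrow> real) set" where
  "Q_polytope G = {z \<in> cube G. \<forall>i j. {i, j} \<in> edges G \<longrightarrow>
     0 \<le> z (Inr {i, j}) \<and>
     z (Inr {i, j}) \<le> z (Inl i) \<and>
     z (Inr {i, j}) \<le> z (Inl j) \<and>
     z (Inl i) + z (Inl j) \<le> 1 + z (Inr {i, j})}"

definition O_polytope :: "'a graph \<Rightarrow> ('a + 'a set \<Rightarrow> real) set" where
  "O_polytope G = {z \<in> cube G. \<forall>i j. {i, j} \<in> edges G \<longrightarrow>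
     z (Inr {i, j}) \<le> z (Inl i) \<and>
     z (Inr {i, j}) \<le> z (Inl j)}"

text \<open>Lebesgue measure on \<open>\<real>\<close> to the power \<open>coords G\<close>, for finite \<open>G\<close>.\<close>

definition vol :: "'a graph \<Rightarrow> ('a + 'a set \<Rightarrow> real) set \<Rightarrow> real" where
  "vol G S = measure (\<Pi>\<^sub>M c\<in>coords G. lborel) S"

definition alternating :: "nat \<Rightarrow> (nat \<Rightarrow> nat) \<Rightarrow> bool" where
  "alternating k w \<longleftrightarrow>
     (\<forall>i\<in>{1..<k}. if odd i then w i > w (i + 1) else w i < w (i + 1))"

text \<open>For \<open>k = 0\<close> the only permutation of the empty set is the identity, so the value is 1.\<close>

definition euler_number :: "nat \<Rightarrow> nat" where
  "euler_number k = card {w. w permutes {1..k} \<and> alternating k w}"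

end

theory Submission
  imports Defs "HOL-Probability.Infinite_Product_Measure"
begin

text \<open>
  Integrate out the edge coordinates. Over a point \<open>x\<close> of the vertex cube the fibre of an edge
  \<open>{i, j}\<close> has length \<open>min x\<^sub>i x\<^sub>j\<close> for the O-polytope and \<open>min {x\<^sub>i, x\<^sub>j, 1 - x\<^sub>i, 1 - x\<^sub>j}\<close>
  for the Q-polytope. The latter is half the former evaluated at the image of \<open>x\<close> under the tent map
  \<open>t \<mapsto> 2 min {t, 1 - t}\<close> in each coordinate, and the tent map preserves the uniform distribution on
  \<open>[0, 1]\<close>; hence each edge contributes exactly one factor \<open>1/2\<close>.

  Listing the coordinates along the path as \<open>x\<^sub>1, y\<^sub>1\<^sub>2, x\<^sub>2, y\<^sub>2\<^sub>3, \<dots>\<close> turns the O-polytope into the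
  set of points of the cube with \<open>z\<^sub>1 \<ge> z\<^sub>2 \<le> z\<^sub>3 \<ge> \<dots>\<close>. Almost every point of the cube lies in the order
  cell of exactly one permutation, the \<open>n!\<close> cells have equal volume, and those contained in this set
  are the cells of the alternating permutations.
\<close>

section \<open>The uniform distribution on [0, 1] and its finite powers\<close>

text \<open>A probability measure on the whole line: the cube constraint moves from the set into the
  measure, and theorems on products of probability spaces become available.\<close>

definition unif01 :: "real measure" where
  "unif01 = uniform_measure lborel {0..1}"

lemma sets_unif01 [simp, measurable_cong]: "sets unif01 = sets borel"
  by (simp add: unif01_def)

lemma space_unif01 [simp]: "space unif01 = UNIV"
  by (simp add: unif01_def)

lemma prob_space_unif01: "prob_space unif01"
  unfolding unif01_def by (rule prob_space_uniform_measure) auto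

interpretation unif01s: product_sigma_finite "\<lambda>_. unif01"
  by unfold_locales (rule sigma_finite_measure.sigma_finite_countable[OF
    prob_space_imp_sigma_finite[OF prob_space_unif01]])

lemma emeasure_unif01:
  "A \<in> sets borel \<Longrightarrow> emeasure unif01 A = emeasure lborel ({0..1} \<inter> A)"
  by (simp add: unif01_def divide_ennreal_def)

lemma AE_unif01: "AE x in unif01. x \<in> {0..1}"
  unfolding unif01_def by (rule AE_uniform_measureI) auto

lemma emeasure_unif01_Icc:
  "0 \<le> a \<Longrightarrow> a \<le> b \<Longrightarrow> b \<le> 1 \<Longrightarrow> emeasure unif01 {a..b} = ennreal (b - a)"
  by (simp add: emeasure_unif01 Int_absorb1)

text \<open>A product measure is determined by its values on boxes, and there the density cuts each
  side \<open>A i\<close> down to its part in [0, 1], whose length is the \<open>unif01\<close>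
  measure of \<open>A i\<close>.\<close>

lemma PiM_unif01_eq_density:
  assumes "finite I"
  shows "PiM I (\<lambda>_. unif01) = density (PiM I (\<lambda>_. lborel)) (indicator (PiE I (\<lambda>_. {0..1})))"
proof -
  interpret L: product_sigma_finite "\<lambda>_. lborel :: real measure"
    by unfold_locales
  have sets_eq: "sets (PiM I (\<lambda>_. lborel)) = sets (PiM I (\<lambda>_. unif01))"
    by (rule sets_PiM_cong) auto
  have C: "PiE I (\<lambda>_. {0..1}) \<in> sets (PiM I (\<lambda>_. lborel :: real measure))"
    using assms by (intro sets_PiM_I_finite) auto
  show ?thesis
  proof (rule unif01s.PiM_eqI[symmetric])
    fix A :: "'a \<Rightarrow> real set"
    assume A: "\<And>i. i \<in> I \<Longrightarrow> A i \<in> sets unif01"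
    have "PiE I A \<in> sets (PiM I (\<lambda>_. lborel :: real measure))"
      using assms A by (intro sets_PiM_I_finite) auto
    then have "emeasure (density (PiM I (\<lambda>_. lborel)) (indicator (PiE I (\<lambda>_. {0..1})))) (PiE I A)
        = emeasure (PiM I (\<lambda>_. lborel)) (PiE I (\<lambda>i. {0..1} \<inter> A i))"
      using C by (simp add: emeasure_density nn_integral_indicator flip: indicator_inter_arith PiE_Int)
    also have "\<dots> = (\<Prod>i\<in>I. emeasure unif01 (A i))"
      using assms A by (subst L.emeasure_PiM) (auto simp: emeasure_unif01)
    finally show "emeasure (density (PiM I (\<lambda>_. lborel)) (indicator (PiE I (\<lambda>_. {0..1})))) (PiE I A)
        = (\<Prod>i\<in>I. emeasure unif01 (A i))" .
  qed (use assms sets_eq in auto)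
qed

lemma emeasure_PiM_unif01:
  assumes "finite I" "A \<in> sets (PiM I (\<lambda>_. borel))"
  shows "emeasure (PiM I (\<lambda>_. unif01)) A
    = emeasure (PiM I (\<lambda>_. lborel)) (PiE I (\<lambda>_. {0..1}) \<inter> A)"
proof -
  have "sets (PiM I (\<lambda>_. lborel :: real measure)) = sets (PiM I (\<lambda>_. borel))"
    by (rule sets_PiM_cong) auto
  then have "A \<in> sets (PiM I (\<lambda>_. lborel))"
    using assms by simp
  moreover have "PiE I (\<lambda>_. {0..1}) \<in> sets (PiM I (\<lambda>_. lborel :: real measure))"
    using assms by (intro sets_PiM_I_finite) auto
  ultimately show ?thesis
    by (simp add: PiM_unif01_eq_density[OF assms(1)] emeasure_density flip: indicator_inter_arith)
qed

section \<open>Invariance of the uniform distribution under the tent map\<close>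

definition tent :: "real \<Rightarrow> real" where
  "tent x = 2 * min x (1 - x)"

lemma tent_measurable [measurable]: "tent \<in> borel_measurable borel"
  unfolding tent_def by measurable

text \<open>The two branches \<open>2 * x\<close> and \<open>2 - 2 * x\<close> each map half of
  [0, 1] affinely onto [0, 1], so each contributes half the measure of \<open>A\<close> to the
  preimage.\<close>

lemma distr_unif01_tent: "distr unif01 unif01 tent = unif01"
proof (rule measure_eqI)
  fix A assume "A \<in> sets (distr unif01 unif01 tent)"
  then have A [measurable]: "A \<in> sets borel" by simp
  let ?B = "{0..1} \<inter> A"
  have vA: "tent -` A \<in> sets borel"
    using measurable_sets[OF tent_measurable A] by simp
  \<comment> \<open>Affine substitution with slope 2 or -2, applied below to one branch each. The
    identities are kept doubled, and the factor 2 is cancelled at the end.\<close>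
  have half: "emeasure lborel ?B = 2 * (\<integral>\<^sup>+x. indicator ?B (t + c * x) \<partial>lborel)"
    if "\<bar>c\<bar> = 2" for t c :: real
    using nn_integral_real_affine[of "indicator ?B" c t] that by (simp add: nn_integral_indicator)
  have "2 * emeasure unif01 (tent -` A) = 2 * (\<integral>\<^sup>+x. indicator ({0..1} \<inter> tent -` A) x \<partial>lborel)"
    using vA by (simp add: emeasure_unif01)
  also have "(\<integral>\<^sup>+x. indicator ({0..1} \<inter> tent -` A) x \<partial>lborel)
      = (\<integral>\<^sup>+x. indicator ?B (0 + 2 * x) + indicator ?B (2 + (-2) * x) \<partial>lborel)"
  proof (rule nn_integral_cong_AE)
    \<comment> \<open>Both branches take the value 1 at 1/2, so the sum of indicators may count this
      point twice; it is the only exception.\<close>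
    have "AE x in lborel. x \<noteq> (1/2::real)"
      by (rule AE_lborel_singleton)
    then show "AE x in lborel. indicator ({0..1} \<inter> tent -` A) x
        = (indicator ?B (0 + 2 * x) + indicator ?B (2 + (-2) * x) :: ennreal)"
      by eventually_elim (auto simp: tent_def indicator_def min_def split: if_splits)
  qed
  also have "\<dots> = (\<integral>\<^sup>+x. indicator ?B (0 + 2 * x) \<partial>lborel)
      + (\<integral>\<^sup>+x. indicator ?B (2 + (-2) * x) \<partial>lborel)"
    by (rule nn_integral_add) measurable
  also have "2 * \<dots> = emeasure lborel ?B + emeasure lborel ?B"
    unfolding distrib_left by (intro arg_cong2[where f = "(+)"] half[symmetric]) simp_all
  also have "\<dots> = 2 * emeasure lborel ?B"
    by (rule mult_2[symmetric])
  finally have "emeasure unif01 (tent -` A) = emeasure lborel ?B"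
    by (simp add: ennreal_mult_cancel_left)
  then show "emeasure (distr unif01 unif01 tent) A = emeasure unif01 A"
    by (simp add: emeasure_distr emeasure_unif01)
qed simp

lemma distr_PiM_unif01_tent:
  assumes "finite I"
  shows "distr (PiM I (\<lambda>_. unif01)) (PiM I (\<lambda>_. unif01)) (compose I tent) = PiM I (\<lambda>_. unif01)"
proof -
  have "distr (PiM I (\<lambda>_. unif01)) (PiM I (\<lambda>_. unif01)) (compose I tent)
      = PiM I (\<lambda>_. distr unif01 unif01 tent)"
    by (rule distr_PiM_finite_prob_space') (use assms prob_space_unif01 in auto)
  then show ?thesis by (simp add: distr_unif01_tent)
qed

section \<open>Null sets and iterated integrals in powers of the uniform distribution\<close>

lemma AE_PiM_unif01:
  assumes "finite I"
  shows "AE x in PiM I (\<lambda>_. unif01). \<forall>i\<in>I. x i \<in> {0..1}"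
  by (intro AE_finite_allI[OF assms] AE_PiM_component prob_space_unif01 AE_unif01)

text \<open>Fubini with coordinate \<open>i\<close> integrated first: once the others are fixed, the
  tie \<open>x i = x j\<close> leaves a single value for \<open>x i\<close>, and points are
  null.\<close>

lemma AE_PiM_unif01_neq:
  assumes "finite I" "i \<in> I" "j \<in> I" "i \<noteq> j"
  shows "AE x in PiM I (\<lambda>_. unif01). x i \<noteq> x j"
proof -
  define J where "J = I - {i}"
  have I: "I = insert i J" and J: "finite J" "i \<notin> J" "j \<in> J"
    using assms by (auto simp: J_def)
  have ms [measurable]: "{x \<in> space (PiM I (\<lambda>_. unif01)). x i = x j} \<in> sets (PiM I (\<lambda>_. unif01))"
    using assms by measurable
  have "emeasure (PiM I (\<lambda>_. unif01)) {x \<in> space (PiM I (\<lambda>_. unif01)). x i = x j}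
      = (\<integral>\<^sup>+x. indicator {x \<in> space (PiM I (\<lambda>_. unif01)). x i = x j} x \<partial>PiM I (\<lambda>_. unif01))"
    by (simp add: nn_integral_indicator)
  also have "\<dots> = (\<integral>\<^sup>+x. \<integral>\<^sup>+y. indicator {x \<in> space (PiM I (\<lambda>_. unif01)). x i = x j} (x(i := y))
      \<partial>unif01 \<partial>PiM J (\<lambda>_. unif01))"
    unfolding I by (rule unif01s.product_nn_integral_insert) (use J ms I in auto)
  also have "\<dots> = (\<integral>\<^sup>+x. \<integral>\<^sup>+y. indicator {x j} y \<partial>unif01 \<partial>PiM J (\<lambda>_. unif01))"
    using J assms(4) unfolding I
    by (intro nn_integral_cong) (auto simp: indicator_def space_PiM PiE_def extensional_def)
  also have "\<dots> = 0"
  proof -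
    have "emeasure unif01 {c} = 0" for c
      using emeasure_mono[of "{0..1} \<inter> {c}" "{c}" lborel] by (simp add: emeasure_unif01)
    then show ?thesis by (simp add: nn_integral_indicator)
  qed
  finally show ?thesis
    using ms by (subst AE_iff_measurable[OF _ refl]) auto
qed

text \<open>Fubini with the coordinates in \<open>J\<close> integrated first; a fibre that is a box
  has the product of the measures of its sides. Fibres are described over the unit cube only, where
  almost every \<open>x\<close> lies.\<close>

lemma emeasure_PiM_unif01_fibres:
  assumes fin: "finite I" "finite J" and disj: "I \<inter> J = {}"
    and A: "A \<in> sets (PiM (I \<union> J) (\<lambda>_. unif01))"
    and S: "\<And>x j. j \<in> J \<Longrightarrow> S x j \<in> sets borel"
    and fibre: "\<And>x. (\<And>i. i \<in> I \<Longrightarrow> x i \<in> {0..1}) \<Longrightarrow>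
      {y \<in> space (PiM J (\<lambda>_. unif01)). merge I J (x, y) \<in> A} = PiE J (S x)"
  shows "emeasure (PiM (I \<union> J) (\<lambda>_. unif01)) A
    = (\<integral>\<^sup>+x. (\<Prod>j\<in>J. emeasure unif01 (S x j)) \<partial>PiM I (\<lambda>_. unif01))"
proof -
  have "emeasure (PiM (I \<union> J) (\<lambda>_. unif01)) A = (\<integral>\<^sup>+z. indicator A z \<partial>PiM (I \<union> J) (\<lambda>_. unif01))"
    using A by simp
  also have "\<dots> = (\<integral>\<^sup>+x. (\<integral>\<^sup>+y. indicator A (merge I J (x, y)) \<partial>PiM J (\<lambda>_. unif01)) \<partial>PiM I (\<lambda>_. unif01))"
    by (rule unif01s.product_nn_integral_fold) (use disj fin A in auto)
  also have "\<dots> = (\<integral>\<^sup>+x. (\<Prod>j\<in>J. emeasure unif01 (S x j)) \<partial>PiM I (\<lambda>_. unif01))"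
  proof (rule nn_integral_cong_AE, rule AE_mp[OF AE_PiM_unif01[OF fin(1)]], intro AE_I2 impI)
    fix x :: "'a \<Rightarrow> real" assume x: "\<forall>i\<in>I. x i \<in> {0..1}"
    have sets: "PiE J (S x) \<in> sets (PiM J (\<lambda>_. unif01))"
      using fin S by (intro sets_PiM_I_finite) auto
    have "(\<integral>\<^sup>+y. indicator A (merge I J (x, y)) \<partial>PiM J (\<lambda>_. unif01))
        = (\<integral>\<^sup>+y. indicator (PiE J (S x)) y \<partial>PiM J (\<lambda>_. unif01))"
      using fibre[of x] x by (intro nn_integral_cong) (auto simp: indicator_def)
    also have "\<dots> = (\<Prod>j\<in>J. emeasure unif01 (S x j))"
      using sets fin S by (simp add: unif01s.emeasure_PiM)
    finally show "(\<integral>\<^sup>+y. indicator A (merge I J (x, y)) \<partial>PiM J (\<lambda>_. unif01))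
        = (\<Prod>j\<in>J. emeasure unif01 (S x j))" .
  qed
  finally show ?thesis .
qed

section \<open>Integrating out the edge coordinates and comparing the two polytopes\<close>

lemma vol_eq_measure_unif01:
  assumes "finite (coords G)" "A \<in> sets (PiM (coords G) (\<lambda>_. borel))"
  shows "vol G (cube G \<inter> A) = measure (PiM (coords G) (\<lambda>_. unif01)) A"
  unfolding vol_def measure_def cube_def by (simp add: emeasure_PiM_unif01[OF assms])

text \<open>A common form for both polytopes: given the vertex coordinates, the edge coordinates
  vary independently, each in an interval from \<open>a\<close> to \<open>b\<close>. By
  \<open>ab\<close> the interval lies in [0, 1], so its uniform measure is its length.\<close>

lemma vol_edge_slabs:
  fixes V :: "'a set" and E :: "'a set set" and a b :: "real \<times> real \<Rightarrow> real"
  assumes fin: "finite V" "finite E"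
    and pq: "\<And>e. e \<in> E \<Longrightarrow> p e \<in> V \<and> q e \<in> V"
    and meas: "a \<in> borel_measurable borel" "b \<in> borel_measurable borel"
    and ab: "\<And>u v. u \<in> {0..1} \<Longrightarrow> v \<in> {0..1} \<Longrightarrow> 0 \<le> a (u, v) \<and> a (u, v) \<le> b (u, v) \<and> b (u, v) \<le> 1"
  shows "vol (V, E) {z \<in> cube (V, E). \<forall>e\<in>E.
        a (z (Inl (p e)), z (Inl (q e))) \<le> z (Inr e) \<and> z (Inr e) \<le> b (z (Inl (p e)), z (Inl (q e)))}
    = enn2real (\<integral>\<^sup>+x. (\<Prod>e\<in>E. ennreal (b (x (Inl (p e)), x (Inl (q e))) - a (x (Inl (p e)), x (Inl (q e)))))
        \<partial>PiM (Inl ` V :: ('a + 'a set) set) (\<lambda>_. unif01))"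
proof -
  let ?I = "Inl ` V :: ('a + 'a set) set" and ?J = "Inr ` E :: ('a + 'a set) set"
  let ?a = "\<lambda>x e. a (x (Inl (p e)), x (Inl (q e)))" and ?b = "\<lambda>x e. b (x (Inl (p e)), x (Inl (q e)))"
  \<comment> \<open>The sides of the fibre are indexed by coordinates \<open>Inr e\<close>;
    \<open>projr\<close> recovers the edge.\<close>
  define S where "S x j = {?a x (projr j) .. ?b x (projr j)}"
    for x :: "'a + 'a set \<Rightarrow> real" and j :: "'a + 'a set"
  define A where "A = {z \<in> space (PiM (?I \<union> ?J) (\<lambda>_. borel)).
    \<forall>e\<in>E. ?a z e \<le> z (Inr e) \<and> z (Inr e) \<le> ?b z e}"
  have coords: "coords (V, E) = ?I \<union> ?J"
    by (auto simp: coords_def)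
  have A: "A \<in> sets (PiM (?I \<union> ?J) (\<lambda>_. borel))"
    unfolding A_def
  proof (rule sets.sets_Collect_finite_All[OF _ fin(2)])
    fix e assume e: "e \<in> E"
    let ?M = "PiM (?I \<union> ?J) (\<lambda>_. borel :: real measure)"
    have comp: "(\<lambda>z. z (Inl (p e))) \<in> borel_measurable ?M" "(\<lambda>z. z (Inl (q e))) \<in> borel_measurable ?M"
      "(\<lambda>z. z (Inr e)) \<in> borel_measurable ?M"
      using pq[OF e] e by (auto intro!: measurable_component_singleton)
    have pair: "(\<lambda>z. (z (Inl (p e)), z (Inl (q e)))) \<in> borel_measurable ?M"
      using comp(1,2) by (rule borel_measurable_Pair)
    show "{z \<in> space ?M. ?a z e \<le> z (Inr e) \<and> z (Inr e) \<le> ?b z e} \<in> sets ?M"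
      by (intro sets.sets_Collect_conj borel_measurable_le comp(3)
          measurable_compose[OF pair meas(1)] measurable_compose[OF pair meas(2)])
  qed
  have "vol (V, E) {z \<in> cube (V, E). \<forall>e\<in>E. ?a z e \<le> z (Inr e) \<and> z (Inr e) \<le> ?b z e}
      = vol (V, E) (cube (V, E) \<inter> A)"
    by (rule arg_cong[where f = "vol (V, E)"]) (auto simp: A_def cube_def coords space_PiM PiE_def)
  also have "\<dots> = measure (PiM (?I \<union> ?J) (\<lambda>_. unif01)) A"
    using vol_eq_measure_unif01[of "(V, E)" A] A fin by (simp add: coords)
  also have "\<dots> = enn2real (\<integral>\<^sup>+x. (\<Prod>j\<in>?J. emeasure unif01 (S x j)) \<partial>PiM ?I (\<lambda>_. unif01))"
    unfolding measure_def
  proof (subst emeasure_PiM_unif01_fibres[where S = S and I = ?I and J = ?J])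
    have "sets (PiM (?I \<union> ?J) (\<lambda>_. unif01)) = sets (PiM (?I \<union> ?J) (\<lambda>_. borel))"
      by (rule sets_PiM_cong) auto
    then show "A \<in> sets (PiM (?I \<union> ?J) (\<lambda>_. unif01))"
      using A by simp
  next
    fix x :: "'a + 'a set \<Rightarrow> real"
    have merge_Inl: "merge ?I ?J (x, y) (Inl i) = x (Inl i)" if "i \<in> V" for y i
      using that by (simp add: merge_def)
    have merge_Inr: "merge ?I ?J (x, y) (Inr e) = y (Inr e)" if "e \<in> E" for y e
      using that by (auto simp: merge_def)
    show "{y \<in> space (PiM ?J (\<lambda>_. unif01)). merge ?I ?J (x, y) \<in> A} = PiE ?J (S x)"
      using pq by (auto simp: A_def S_def space_PiM merge_Inl merge_Inr PiE_iff extensional_def)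
  qed (use fin in \<open>auto simp: S_def\<close>)
  also have "(\<integral>\<^sup>+x. (\<Prod>j\<in>?J. emeasure unif01 (S x j)) \<partial>PiM ?I (\<lambda>_. unif01))
      = (\<integral>\<^sup>+x. (\<Prod>e\<in>E. ennreal (?b x e - ?a x e)) \<partial>PiM ?I (\<lambda>_. unif01))"
  proof (rule nn_integral_cong_AE, rule AE_mp[OF AE_PiM_unif01], use fin in simp, intro AE_I2 impI)
    fix x :: "'a + 'a set \<Rightarrow> real" assume x: "\<forall>i\<in>?I. x i \<in> {0..1}"
    have "(\<Prod>j\<in>?J. emeasure unif01 (S x j)) = (\<Prod>e\<in>E. emeasure unif01 (S x (Inr e)))"
      by (subst prod.reindex) (auto simp: inj_on_def)
    also have "\<dots> = (\<Prod>e\<in>E. ennreal (?b x e - ?a x e))"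
    proof (rule prod.cong[OF refl])
      fix e assume "e \<in> E"
      then show "emeasure unif01 (S x (Inr e)) = ennreal (?b x e - ?a x e)"
        unfolding S_def using x pq[of e] ab[of "x (Inl (p e))" "x (Inl (q e))"]
        by (simp add: emeasure_unif01_Icc)
    qed
    finally show "(\<Prod>j\<in>?J. emeasure unif01 (S x j)) = (\<Prod>e\<in>E. ennreal (?b x e - ?a x e))" .
  qed
  finally show ?thesis .
qed

text \<open>This is not special to paths: the tent map acts on all vertex coordinates at once, and
  every edge factor of the integrand is halved separately.\<close>

lemma vol_Q_polytope:
  fixes V :: "'a set"
  assumes fin: "finite V" "finite E" and ends: "\<And>e. e \<in> E \<Longrightarrow> \<exists>i\<in>V. \<exists>j\<in>V. e = {i, j}"
  shows "vol (V, E) (Q_polytope (V, E)) = vol (V, E) (O_polytope (V, E)) / 2 ^ card E"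
proof -
  \<comment> \<open>An arbitrary orientation of the edges, as \<open>vol_edge_slabs\<close> takes
    endpoints as an ordered pair.\<close>
  obtain p q where pq: "\<And>e. e \<in> E \<Longrightarrow> p e \<in> V \<and> q e \<in> V \<and> e = {p e, q e}"
    using ends by metis
  let ?I = "Inl ` V :: ('a + 'a set) set"
  let ?P = "PiM ?I (\<lambda>_. unif01)"
  let ?min = "\<lambda>x e. min (x (Inl (p e))) (x (Inl (q e))) :: real"
  \<comment> \<open>The polytopes quantify over both ways of writing an edge as
    \<open>{i, j}\<close>; for a symmetric condition the chosen orientation suffices.\<close>
  have edge: "(\<forall>i j. {i, j} \<in> E \<longrightarrow> R {i, j} i j) \<longleftrightarrow> (\<forall>e\<in>E. R e (p e) (q e))"
    if sym: "\<And>e i j. R e i j \<longleftrightarrow> R e j i" for R :: "'a set \<Rightarrow> 'a \<Rightarrow> 'a \<Rightarrow> bool"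
  proof safe
    fix e assume "\<forall>i j. {i, j} \<in> E \<longrightarrow> R {i, j} i j" "e \<in> E"
    then show "R e (p e) (q e)" using pq[of e] by metis
  next
    fix i j assume *: "\<forall>e\<in>E. R e (p e) (q e)" "{i, j} \<in> E"
    with pq[of "{i, j}"] have "p {i, j} = i \<and> q {i, j} = j \<or> p {i, j} = j \<and> q {i, j} = i"
      by (auto simp: doubleton_eq_iff)
    with * sym show "R {i, j} i j" by metis
  qed
  have O: "O_polytope (V, E) = {z \<in> cube (V, E). \<forall>e\<in>E. 0 \<le> z (Inr e) \<and> z (Inr e) \<le> ?min z e}"
  proof -
    \<comment> \<open>The lower end 0 of the slab comes from the cube.\<close>
    have "0 \<le> z (Inr e)" if "z \<in> cube (V, E)" "e \<in> E" for z e
      using that by (auto simp: cube_def coords_def dest!: PiE_mem)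
    moreover have "(\<forall>i j. {i, j} \<in> E \<longrightarrow> z (Inr {i, j}) \<le> z (Inl i) \<and> z (Inr {i, j}) \<le> z (Inl j)) \<longleftrightarrow>
        (\<forall>e\<in>E. z (Inr e) \<le> z (Inl (p e)) \<and> z (Inr e) \<le> z (Inl (q e)))"
      for z :: "'a + 'a set \<Rightarrow> real"
      by (rule edge) auto
    ultimately show ?thesis
      unfolding O_polytope_def snd_conv by auto
  qed
  have Q: "Q_polytope (V, E) = {z \<in> cube (V, E). \<forall>e\<in>E.
      max 0 (z (Inl (p e)) + z (Inl (q e)) - 1) \<le> z (Inr e) \<and> z (Inr e) \<le> ?min z e}"
  proof -
    have "(\<forall>i j. {i, j} \<in> E \<longrightarrow> 0 \<le> z (Inr {i, j}) \<and> z (Inr {i, j}) \<le> z (Inl i) \<and>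
          z (Inr {i, j}) \<le> z (Inl j) \<and> z (Inl i) + z (Inl j) \<le> 1 + z (Inr {i, j})) \<longleftrightarrow>
        (\<forall>e\<in>E. 0 \<le> z (Inr e) \<and> z (Inr e) \<le> z (Inl (p e)) \<and>
          z (Inr e) \<le> z (Inl (q e)) \<and> z (Inl (p e)) + z (Inl (q e)) \<le> 1 + z (Inr e))"
      for z :: "'a + 'a set \<Rightarrow> real"
      by (rule edge) (auto simp: add.commute)
    then show ?thesis
      unfolding Q_polytope_def snd_conv by (auto simp: algebra_simps)
  qed
  have bounds_meas: "(\<lambda>p. min (fst p) (snd p) :: real) \<in> borel_measurable borel"
    "(\<lambda>p. max 0 (fst p + snd p - 1) :: real) \<in> borel_measurable borel"
    unfolding borel_prod[symmetric] by measurable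
  have volO: "vol (V, E) (O_polytope (V, E)) = enn2real (\<integral>\<^sup>+x. (\<Prod>e\<in>E. ennreal (?min x e)) \<partial>?P)"
    using vol_edge_slabs[of V E p q "\<lambda>_. 0" "\<lambda>p. min (fst p) (snd p)"] fin pq bounds_meas
    by (simp add: O min_le_iff_disj)
  have comp: "(\<lambda>x. x (Inl i)) \<in> borel_measurable ?P" if "i \<in> V" for i
  proof -
    have "(\<lambda>x. x (Inl i)) \<in> measurable ?P unif01"
      using that by (intro measurable_component_singleton) simp
    also have "measurable ?P unif01 = borel_measurable ?P"
      by (rule measurable_cong_sets) simp_all
    finally show ?thesis .
  qed
  have [measurable]: "(\<lambda>x. ?min x e) \<in> borel_measurable ?P" if "e \<in> E" for e
    using pq[OF that] by (intro borel_measurable_min comp) auto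
  have prod_meas: "(\<lambda>x. \<Prod>e\<in>E. ennreal (?min x e)) \<in> borel_measurable ?P"
    by measurable
  have tent_meas: "compose ?I tent \<in> measurable ?P ?P"
    unfolding compose_def
    by (rule measurable_restrict, rule measurable_compose[OF measurable_component_singleton]) auto
  have "vol (V, E) (Q_polytope (V, E)) = enn2real (\<integral>\<^sup>+x. (\<Prod>e\<in>E. ennreal
      (?min x e - max 0 (x (Inl (p e)) + x (Inl (q e)) - 1))) \<partial>?P)"
    using vol_edge_slabs[of V E p q "\<lambda>p. max 0 (fst p + snd p - 1)" "\<lambda>p. min (fst p) (snd p)"] fin pq bounds_meas
    by (simp add: Q min_le_iff_disj)
  \<comment> \<open>For all reals, \<open>min u v - max 0 (u + v - 1)\<close> is the least of
    \<open>u\<close>, \<open>v\<close>, \<open>1 - u\<close>, \<open>1 - v\<close>, which is half of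
    \<open>min (tent u) (tent v)\<close>. The identity thus holds pointwise, even off the
    cube.\<close>
  also have "(\<integral>\<^sup>+x. (\<Prod>e\<in>E. ennreal (?min x e - max 0 (x (Inl (p e)) + x (Inl (q e)) - 1))) \<partial>?P)
      = (\<integral>\<^sup>+x. (\<Prod>e\<in>E. ennreal (1/2) * ennreal (?min (compose ?I tent x) e)) \<partial>?P)"
    using pq by (intro nn_integral_cong prod.cong refl, subst ennreal_mult'[symmetric])
      (auto intro!: arg_cong[where f = ennreal] simp: compose_def tent_def min_def)
  also have "\<dots> = ennreal (1/2) ^ card E * (\<integral>\<^sup>+x. (\<Prod>e\<in>E. ennreal (?min (compose ?I tent x) e)) \<partial>?P)"
    unfolding prod.distrib prod_constant
    by (rule nn_integral_cmult, rule measurable_compose[OF tent_meas prod_meas])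
  also have "(\<integral>\<^sup>+x. (\<Prod>e\<in>E. ennreal (?min (compose ?I tent x) e)) \<partial>?P)
      = (\<integral>\<^sup>+x. (\<Prod>e\<in>E. ennreal (?min x e)) \<partial>distr ?P ?P (compose ?I tent))"
    by (rule nn_integral_distr[symmetric, OF tent_meas]) (use prod_meas in simp)
  also have "distr ?P ?P (compose ?I tent) = ?P"
    using fin by (intro distr_PiM_unif01_tent) simp
  also have "ennreal (1/2) ^ card E = ennreal ((1/2) ^ card E)"
    by (rule ennreal_power) simp
  finally show ?thesis
    by (simp only: volO enn2real_mult enn2real_ennreal) (simp add: power_divide)
qed

section \<open>Order cells of permutations\<close>

text \<open>For a permutation \<open>w\<close>, the value \<open>w i\<close> is the rank of
  \<open>z i\<close>, and ties are excluded by injectivity. Using ranks instead of the sorting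
  permutation lets comparisons of neighbouring coordinates be read off \<open>w\<close>
  directly.\<close>

definition order_cell :: "nat \<Rightarrow> (nat \<Rightarrow> nat) \<Rightarrow> (nat \<Rightarrow> real) set" where
  "order_cell n w = {z \<in> space (PiM {1..n} (\<lambda>_. unif01)).
     \<forall>i\<in>{1..n}. \<forall>j\<in>{1..n}. z i < z j \<longleftrightarrow> w i < w j}"

lemma order_cell_sets [measurable]: "order_cell n w \<in> sets (PiM {1..n} (\<lambda>_. unif01))"
  unfolding order_cell_def by measurable

text \<open>Every value from 1 to \<open>w i - 1\<close> is attained exactly once. So a permutation
  is recovered from the order pattern of its values, which makes the cells disjoint.\<close>

lemma permutes_eq_card_less:
  assumes "w permutes {1..n}" "i \<in> {1..n}"
  shows "w i = Suc (card {j \<in> {1..n}. w j < w i})"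
proof -
  have "w ` {j \<in> {1..n}. w j < w i} = {1..<w i}"
  proof safe
    fix j assume "j \<in> {1..n}"
    then show "w j \<in> {1..<w i}" if "w j < w i"
      using that permutes_in_image[OF assms(1), of j] by auto
  next
    fix k assume k: "k \<in> {1..<w i}"
    have "w i \<in> {1..n}" using assms by (simp only: permutes_in_image)
    with k have "k \<in> w ` {1..n}" unfolding permutes_image[OF assms(1)] by auto
    with k show "k \<in> w ` {j \<in> {1..n}. w j < w i}" by auto
  qed
  moreover have "inj_on w {j \<in> {1..n}. w j < w i}"
    using permutes_inj[OF assms(1)] by (rule inj_on_subset) auto
  ultimately have "card {j \<in> {1..n}. w j < w i} = card {1..<w i}"
    by (metis card_image)
  moreover have "w i \<in> {1..n}" using assms by (simp only: permutes_in_image)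
  ultimately show ?thesis by simp
qed

lemma order_cell_disjoint:
  assumes "v permutes {1..n}" "w permutes {1..n}" "z \<in> order_cell n v" "z \<in> order_cell n w"
  shows "v = w"
proof
  fix i
  show "v i = w i"
  proof (cases "i \<in> {1..n}")
    case True
    then have "{j \<in> {1..n}. v j < v i} = {j \<in> {1..n}. w j < w i}"
      using assms(3,4) by (auto simp: order_cell_def)
    then show ?thesis
      using permutes_eq_card_less[OF assms(1) True] permutes_eq_card_less[OF assms(2) True] by simp
  qed (use assms in \<open>simp add: permutes_def\<close>)
qed

lemma ex_order_cell:
  assumes z: "z \<in> space (PiM {1..n} (\<lambda>_. unif01))" and inj: "inj_on z {1..n}"
  shows "\<exists>w. w permutes {1..n} \<and> z \<in> order_cell n w"
proof -
  \<comment> \<open>The rank of \<open>z i\<close>; the weak inequality counts \<open>i\<close>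
    itself, so ranks start at 1. Outside \<open>{1..n}\<close> the permutation \<open>w\<close> must
    be the identity.\<close>
  define r where "r i = card {j \<in> {1..n}. z j \<le> z i}" for i
  define w where "w i = (if i \<in> {1..n} then r i else i)" for i
  have less: "r i < r j" if "i \<in> {1..n}" "j \<in> {1..n}" "z i < z j" for i j
    unfolding r_def
  proof (rule psubset_card_mono)
    have "j \<in> {k \<in> {1..n}. z k \<le> z j} - {k \<in> {1..n}. z k \<le> z i}"
      using that by simp
    moreover have "{k \<in> {1..n}. z k \<le> z i} \<subseteq> {k \<in> {1..n}. z k \<le> z j}"
      using that by auto
    ultimately show "{k \<in> {1..n}. z k \<le> z i} \<subset> {k \<in> {1..n}. z k \<le> z j}"
      by blast
  qed simp
  have iff: "z i < z j \<longleftrightarrow> w i < w j" if "i \<in> {1..n}" "j \<in> {1..n}" for i j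
    using less[of i j] less[of j i] inj that
    by (cases "z i" "z j" rule: linorder_cases) (auto simp: w_def dest: inj_onD)
  have "w i \<in> {1..n}" if "i \<in> {1..n}" for i
  proof -
    have "r i \<le> card {1..n}" unfolding r_def by (rule card_mono) auto
    moreover have "r i \<noteq> 0" using that by (auto simp: r_def)
    ultimately show ?thesis using that by (simp add: w_def)
  qed
  moreover have "inj_on w {1..n}"
  proof (rule inj_onI)
    fix i j assume ij: "i \<in> {1..n}" "j \<in> {1..n}" "w i = w j"
    then have "z i = z j" using iff[of i j] iff[of j i] by simp
    with inj ij show "i = j" by (auto dest: inj_onD)
  qed
  ultimately have "bij_betw w {1..n} {1..n}"
    using endo_inj_surj[of "{1..n}" w] by (auto simp only: bij_betw_def)
  then have "w permutes {1..n}"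
    by (rule bij_imp_permutes) (auto simp: w_def)
  with iff z show ?thesis by (auto simp: order_cell_def)
qed

text \<open>Permuting the coordinates preserves the product measure, and reindexing by
  \<open>inv w\<close> pulls the cell of \<open>id\<close> back to the cell of
  \<open>w\<close>.\<close>

lemma measure_order_cell_cong:
  assumes w: "w permutes {1..n}"
  shows "measure (PiM {1..n} (\<lambda>_. unif01)) (order_cell n w)
    = measure (PiM {1..n} (\<lambda>_. unif01)) (order_cell n id)"
proof -
  let ?P = "PiM {1..n} (\<lambda>_. unif01)"
  let ?v = "inv w" and ?t = "\<lambda>z::nat \<Rightarrow> real. \<lambda>i\<in>{1..n}. z (inv w i)"
  have v: "?v permutes {1..n}" using w by (rule permutes_inv)
  have vI: "?v i \<in> {1..n} \<longleftrightarrow> i \<in> {1..n}" for i using v by (rule permutes_in_image)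
  have wI: "w i \<in> {1..n} \<longleftrightarrow> i \<in> {1..n}" for i using w by (rule permutes_in_image)
  have "distr ?P ?P ?t = ?P"
    by (rule distr_PiM_reindex) (use v vI in \<open>blast intro: prob_space_unif01 permutes_inj_on\<close>)+
  then have "measure ?P (order_cell n id) = measure (distr ?P ?P ?t) (order_cell n id)"
    by simp
  also have "\<dots> = measure ?P (?t -` order_cell n id \<inter> space ?P)"
  proof (rule measure_distr)
    show "?t \<in> measurable ?P ?P"
      using vI by (intro measurable_restrict measurable_component_singleton) blast
  qed measurable
  also have "?t -` order_cell n id \<inter> space ?P = order_cell n w"
  proof -
    \<comment> \<open>Substitute \<open>w i\<close> and \<open>w j\<close> for the bound indices,
      and \<open>inv w\<close> of them for the converse.\<close>
    have "(\<forall>i\<in>{1..n}. \<forall>j\<in>{1..n}. z (?v i) < z (?v j) \<longleftrightarrow> i < j) \<longleftrightarrow>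
        (\<forall>i\<in>{1..n}. \<forall>j\<in>{1..n}. z i < z j \<longleftrightarrow> w i < w j)" for z :: "nat \<Rightarrow> real"
      using vI wI permutes_inverses[OF w] by metis
    then show ?thesis
      by (auto simp: order_cell_def space_PiM simp del: atLeastAtMost_iff)
  qed
  finally show ?thesis by (rule sym)
qed

lemma AE_ex_order_cell:
  "AE z in PiM {1..n} (\<lambda>_. unif01). \<exists>w. w permutes {1..n} \<and> z \<in> order_cell n w"
proof -
  have "AE z in PiM {1..n} (\<lambda>_. unif01). \<forall>i\<in>{1..n}. \<forall>j\<in>{1..n}. i \<noteq> j \<longrightarrow> z i \<noteq> z j"
  proof (intro AE_finite_allI)
    fix i j assume "i \<in> {1..n}" "j \<in> {1..n}"
    then show "AE z in PiM {1..n} (\<lambda>_. unif01). i \<noteq> j \<longrightarrow> z i \<noteq> z j"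
      using AE_PiM_unif01_neq[of "{1..n}" i j] by (cases "i = j") auto
  qed auto
  then show ?thesis
    using AE_space by eventually_elim (rule ex_order_cell, auto simp: inj_on_def)
qed

text \<open>Up to a null set, \<open>A\<close> is the disjoint union of the cells of those
  \<open>w\<close> with \<open>P w\<close>, and all cells have equal measure.\<close>

lemma measure_eq_card_order_cells:
  assumes A: "A \<in> sets (PiM {1..n} (\<lambda>_. unif01))"
    and A_iff: "\<And>w z. w permutes {1..n} \<Longrightarrow> z \<in> order_cell n w \<Longrightarrow> z \<in> A \<longleftrightarrow> P w"
  shows "measure (PiM {1..n} (\<lambda>_. unif01)) A = real (card {w. w permutes {1..n} \<and> P w}) *
    measure (PiM {1..n} (\<lambda>_. unif01)) (order_cell n id)"
proof -
  let ?P = "PiM {1..n} (\<lambda>_. unif01)" and ?W = "{w. w permutes {1..n} \<and> P w}"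
  interpret prob_space ?P
    by (intro prob_space_PiM prob_space_unif01)
  have finW: "finite ?W"
    by (rule finite_subset[OF _ finite_permutations[of "{1..n}"]]) auto
  have "measure ?P A = measure ?P (\<Union>w\<in>?W. order_cell n w)"
  proof (rule finite_measure_eq_AE)
    show "AE z in ?P. z \<in> A \<longleftrightarrow> z \<in> (\<Union>w\<in>?W. order_cell n w)"
      using AE_ex_order_cell
    proof eventually_elim
      case (elim z)
      then obtain w where w: "w permutes {1..n}" "z \<in> order_cell n w" by blast
      then have "z \<in> (\<Union>w\<in>?W. order_cell n w) \<longleftrightarrow> P w"
        using order_cell_disjoint by blast
      with w show ?case using A_iff by blast
    qed
  qed (use A finW in \<open>auto intro: sets.finite_UN order_cell_sets simp del: One_nat_def\<close>)
  also have "\<dots> = (\<Sum>w\<in>?W. measure ?P (order_cell n w))"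
    using finW order_cell_disjoint
    by (intro finite_measure_finite_Union) (auto simp: disjoint_family_on_def intro: order_cell_sets simp del: One_nat_def)
  also have "\<dots> = (\<Sum>w\<in>?W. measure ?P (order_cell n id))"
    by (intro sum.cong refl measure_order_cell_cong) auto
  finally show ?thesis by simp
qed

text \<open>Applied to the whole space, the counting lemma says that \<open>n!\<close> cells of
  equal measure add up to 1.\<close>

lemma measure_order_cell_id:
  "measure (PiM {1..n} (\<lambda>_. unif01)) (order_cell n id) = 1 / fact n"
proof -
  let ?P = "PiM {1..n} (\<lambda>_. unif01)"
  interpret prob_space ?P
    by (intro prob_space_PiM prob_space_unif01)
  have "measure ?P (space ?P) = real (card {w. w permutes {1..n} \<and> True}) * measure ?P (order_cell n id)"
    by (rule measure_eq_card_order_cells) (auto simp: order_cell_def)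
  then have "1 = fact n * measure ?P (order_cell n id)"
    unfolding prob_space by (simp add: card_permutations[OF refl])
  then show ?thesis by (simp add: field_simps)
qed

section \<open>Zigzag points and alternating permutations\<close>

definition zigzag :: "nat \<Rightarrow> (nat \<Rightarrow> real) \<Rightarrow> bool" where
  "zigzag n z \<longleftrightarrow> (\<forall>i\<in>{1..<n}. if odd i then z (i + 1) \<le> z i else z i \<le> z (i + 1))"

lemma zigzag_sets:
  "{z \<in> space (PiM {1..n} (\<lambda>_. unif01)). zigzag n z} \<in> sets (PiM {1..n} (\<lambda>_. unif01))"
  unfolding zigzag_def
proof (rule sets.sets_Collect_finite_All)
  fix i assume "i \<in> {1..<n}"
  then have [measurable]: "i \<in> {1..n}" "i + 1 \<in> {1..n}" by auto
  show "{z \<in> space (PiM {1..n} (\<lambda>_. unif01)). if odd i then z (i + 1) \<le> z i else z i \<le> z (i + 1)}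
      \<in> sets (PiM {1..n} (\<lambda>_. unif01))"
    by (cases "odd i"; simp only: if_True if_False not_True_eq_False not_False_eq_True; measurable)
qed simp

lemma measure_zigzag:
  "measure (PiM {1..n} (\<lambda>_. unif01)) {z \<in> space (PiM {1..n} (\<lambda>_. unif01)). zigzag n z}
    = real (euler_number n) / fact n"
proof -
  have "measure (PiM {1..n} (\<lambda>_. unif01)) {z \<in> space (PiM {1..n} (\<lambda>_. unif01)). zigzag n z}
      = real (card {w. w permutes {1..n} \<and> alternating n w}) *
        measure (PiM {1..n} (\<lambda>_. unif01)) (order_cell n id)"
  proof (rule measure_eq_card_order_cells[OF zigzag_sets])
    fix w z assume w: "w permutes {1..n}" and z: "z \<in> order_cell n w"
    \<comment> \<open>A cell has no ties, so the weak inequalities of \<open>zigzag\<close> agree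
      with the strict ones of \<open>alternating\<close>.\<close>
    have "z i \<le> z j \<longleftrightarrow> w i < w j" if "i \<in> {1..n}" "j \<in> {1..n}" "i \<noteq> j" for i j
    proof -
      have "w i \<noteq> w j" using that permutes_inj[OF w] by (auto dest: injD)
      moreover have "z j < z i \<longleftrightarrow> w j < w i" using z that by (auto simp: order_cell_def)
      ultimately show ?thesis by auto
    qed
    then have "zigzag n z \<longleftrightarrow> alternating n w"
      unfolding zigzag_def alternating_def by (intro ball_cong) auto
    with z show "z \<in> {z \<in> space (PiM {1..n} (\<lambda>_. unif01)). zigzag n z} \<longleftrightarrow> alternating n w"
      by (auto simp: order_cell_def)
  qed
  then show ?thesis by (simp only: measure_order_cell_id euler_number_def) simp
qed

section \<open>Listing the coordinates along the path\<close>

text \<open>Vertex \<open>i\<close> gets position \<open>2 * i - 1\<close> and edge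
  \<open>{i, i + 1}\<close> position \<open>2 * i\<close>. Edges thus sit at the even positions, the
  valleys of a pattern that begins with a descent.\<close>

definition path_coord :: "nat \<Rightarrow> nat + nat set" where
  "path_coord k = (if odd k then Inl ((k + 1) div 2) else Inr {k div 2, k div 2 + 1})"

lemma path_coord_inj: "inj_on path_coord {1..2 * m + 1}"
  by (auto simp: inj_on_def path_coord_def doubleton_eq_iff elim!: oddE evenE split: if_splits)

lemma path_coord_image: "path_coord ` {1..2 * m + 1} = coords (path_graph m)"
proof (intro equalityI subsetI)
  fix c assume "c \<in> coords (path_graph m)"
  then consider i where "c = Inl i" "i \<in> {1..m+1}" | i where "c = Inr {i, i + 1}" "i \<in> {1..m}"
    by (auto simp: coords_def path_graph_def)
  then show "c \<in> path_coord ` {1..2 * m + 1}"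
  proof cases
    case 1
    then have "path_coord (2 * i - 1) = c" "2 * i - 1 \<in> {1..2 * m + 1}"
      by (auto simp: path_coord_def)
    then show ?thesis by blast
  next
    case 2
    then have "path_coord (2 * i) = c" "2 * i \<in> {1..2 * m + 1}"
      by (auto simp: path_coord_def)
    then show ?thesis by blast
  qed
qed (auto simp: coords_def path_graph_def path_coord_def elim!: oddE evenE)

text \<open>Relabelling coordinates along the bijection \<open>path_coord\<close> preserves the
  product measure and turns the edge inequalities into \<open>zigzag\<close>.\<close>

lemma vol_O_polytope_path_graph:
  "vol (path_graph m) (O_polytope (path_graph m)) = real (euler_number (2 * m + 1)) / fact (2 * m + 1)"
proof -
  let ?n = "2 * m + 1"
  let ?C = "coords (path_graph m)" and ?I = "{1..?n}"
  let ?P = "PiM ?C (\<lambda>_. unif01)" and ?R = "PiM ?I (\<lambda>_. unif01)"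
  let ?t = "\<lambda>z::nat + nat set \<Rightarrow> real. \<lambda>k\<in>?I. z (path_coord k)"
  let ?Z = "{z \<in> space ?R. zigzag ?n z}"
  have finC: "finite ?C"
    by (simp flip: path_coord_image)
  have coord_in: "path_coord k \<in> ?C" if "k \<in> ?I" for k
    using that path_coord_image[of m] by blast
  have t_meas: "?t \<in> measurable ?P ?R"
    by (intro measurable_restrict measurable_component_singleton coord_in)
  have Z: "?Z \<in> sets ?R"
    by (rule zigzag_sets)
  have "sets ?P = sets (PiM ?C (\<lambda>_. borel))"
    by (rule sets_PiM_cong) auto
  with measurable_sets[OF t_meas Z]
  have tZ: "?t -` ?Z \<inter> space ?P \<in> sets (PiM ?C (\<lambda>_. borel))" by simp
  have "zigzag ?n (?t z) \<longleftrightarrow> (\<forall>i j. {i, j} \<in> edges (path_graph m) \<longrightarrow>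
     z (Inr {i, j}) \<le> z (Inl i) \<and> z (Inr {i, j}) \<le> z (Inl j))" (is "?L \<longleftrightarrow> ?E") for z
  proof -
    have "?E \<longleftrightarrow> (\<forall>i\<in>{1..m}. z (Inr {i, i + 1}) \<le> z (Inl i) \<and> z (Inr {i, i + 1}) \<le> z (Inl (i + 1)))"
    proof
      assume E: ?E
      show "\<forall>i\<in>{1..m}. z (Inr {i, i + 1}) \<le> z (Inl i) \<and> z (Inr {i, i + 1}) \<le> z (Inl (i + 1))"
      proof
        fix i assume "i \<in> {1..m}"
        then have "{i, i + 1} \<in> edges (path_graph m)" by (auto simp: path_graph_def)
        with E show "z (Inr {i, i + 1}) \<le> z (Inl i) \<and> z (Inr {i, i + 1}) \<le> z (Inl (i + 1))"
          by blast
      qed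
    next
      assume *: "\<forall>i\<in>{1..m}. z (Inr {i, i + 1}) \<le> z (Inl i) \<and> z (Inr {i, i + 1}) \<le> z (Inl (i + 1))"
      show ?E
      proof (intro allI impI)
        fix i j assume "{i, j} \<in> edges (path_graph m)"
        then obtain k where k: "k \<in> {1..m}" "{i, j} = {k, k + 1}" by (auto simp: path_graph_def)
        then have "i = k \<and> j = k + 1 \<or> i = k + 1 \<and> j = k" by (simp add: doubleton_eq_iff)
        then show "z (Inr {i, j}) \<le> z (Inl i) \<and> z (Inr {i, j}) \<le> z (Inl j)"
          unfolding k(2) using * k(1) by auto
      qed
    qed
    also have "\<dots> \<longleftrightarrow> ?L"
    proof
      assume *: "\<forall>i\<in>{1..m}. z (Inr {i, i + 1}) \<le> z (Inl i) \<and> z (Inr {i, i + 1}) \<le> z (Inl (i + 1))"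
      show ?L unfolding zigzag_def
      proof
        fix k assume k: "k \<in> {1..<?n}"
        show "if odd k then ?t z (k + 1) \<le> ?t z k else ?t z k \<le> ?t z (k + 1)"
        proof (cases "odd k")
          case True
          \<comment> \<open>Position \<open>2 * i + 1\<close> is vertex \<open>i + 1\<close>,
            followed by the edge from \<open>i + 1\<close> to \<open>i + 2\<close>; hence the
            instance \<open>i + 1\<close>.\<close>
          then obtain i where "k = 2 * i + 1" by (auto elim: oddE)
          then show ?thesis using k *[rule_format, of "i + 1"] by (simp add: path_coord_def)
        next
          case False
          then obtain i where "k = 2 * i" by (auto elim: evenE)
          then show ?thesis using k *[rule_format, of i] by (simp add: path_coord_def)
        qed
      qed
    next
      assume L: ?L
      show "\<forall>i\<in>{1..m}. z (Inr {i, i + 1}) \<le> z (Inl i) \<and> z (Inr {i, i + 1}) \<le> z (Inl (i + 1))"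
      proof
        fix i assume i: "i \<in> {1..m}"
        \<comment> \<open>The edge at position \<open>2 * i\<close> is compared with its neighbours
          at positions \<open>2 * i - 1\<close> and \<open>2 * i\<close>; writing the former as
          \<open>2 * l + 1\<close> avoids natural subtraction.\<close>
        then obtain l where l: "i = Suc l" by (cases i) auto
        show "z (Inr {i, i + 1}) \<le> z (Inl i) \<and> z (Inr {i, i + 1}) \<le> z (Inl (i + 1))"
          using L[unfolded zigzag_def, rule_format, of "2 * l + 1"]
            L[unfolded zigzag_def, rule_format, of "2 * i"] i
          by (simp add: path_coord_def l)
      qed
    qed
    finally show ?thesis by simp
  qed
  then have "O_polytope (path_graph m) = cube (path_graph m) \<inter> (?t -` ?Z \<inter> space ?P)"
    by (auto simp: O_polytope_def cube_def space_PiM PiE_def)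
  then have "vol (path_graph m) (O_polytope (path_graph m)) = measure ?P (?t -` ?Z \<inter> space ?P)"
    using vol_eq_measure_unif01[OF finC tZ] by simp
  also have "\<dots> = measure (distr ?P ?R ?t) ?Z"
    by (rule measure_distr[symmetric, OF t_meas Z])
  also have "distr ?P ?R ?t = ?R"
    by (rule distr_PiM_reindex) (use path_coord_inj coord_in prob_space_unif01 in auto)
  finally show ?thesis by (simp only: measure_zigzag)
qed

theorem theorem10:
  fixes m :: nat
  shows "vol (path_graph m) (Q_polytope (path_graph m))
           = vol (path_graph m) (O_polytope (path_graph m)) / 2 ^ m
       \<and> vol (path_graph m) (O_polytope (path_graph m)) / 2 ^ m
           = real (euler_number (2 * m + 1)) / (2 ^ m * fact (2 * m + 1))"
proof -
  have edges: "edges (path_graph m) = (\<lambda>i. {i, i + 1}) ` {1..m}"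
    by (auto simp: path_graph_def)
  \<comment> \<open>Distinct indices give distinct edges, so the exponent \<open>card E\<close> of 2
    is exactly \<open>m\<close>.\<close>
  have "inj_on (\<lambda>i. {i, i + 1}) {1..m}"
    by (auto simp: inj_on_def doubleton_eq_iff)
  then have E: "card (edges (path_graph m)) = m" "finite (edges (path_graph m))"
    by (simp_all add: edges card_image)
  have "\<exists>i\<in>verts (path_graph m). \<exists>j\<in>verts (path_graph m). e = {i, j}"
    if e: "e \<in> edges (path_graph m)" for e
  proof -
    obtain i where "i \<in> {1..m}" "e = {i, i + 1}"
      using e unfolding edges by blast
    then have "i \<in> verts (path_graph m)" "i + 1 \<in> verts (path_graph m)" "e = {i, i + 1}"
      by (auto simp: path_graph_def)
    then show ?thesis by blast
  qed
  moreover have "finite (verts (path_graph m))"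
    by (simp add: path_graph_def)
  ultimately have "vol (path_graph m) (Q_polytope (path_graph m))
      = vol (path_graph m) (O_polytope (path_graph m)) / 2 ^ card (edges (path_graph m))"
    using vol_Q_polytope[of "verts (path_graph m)" "edges (path_graph m)"] E(2) by simp
  then show ?thesis
    by (simp add: E vol_O_polytope_path_graph field_simps)
qed

end
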